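(* Let $r,n\ge 1$ be integers with $r$ even. Then $$\sum_{\pi\in G(r,n)}(-1)^{\mathrm{fmaf}(\pi)}q^{\mathrm{rinv}(\pi)}= \sum_{\pi\in G(r,n)}(-1)^{\mathrm{fmaf}(\pi)}q^{\mathrm{rmaj}(\pi)}=\prod_{k=1}^{n}[r]_{-q^k}\,[k]_q.$$
   Context: For an integer $m\ge 0$ and any quantity $p$, $[m]_p:=1+p+\cdots+p^{m-1}$. $G(r,n)=C_r\wr\mathfrak S_n$ is the group of $r$-colored permutations; an element is a word $\pi=\pi_1\cdots\pi_n=\sigma_1^{[z_1]}\cdots\sigma_n^{[z_n]}$ with $\sigma\in\mathfrak S_n$ and colors $z_i\in\{0,1,\dots,r-1\}$, with $i^{[0]}=i$. The colored letters are ordered linearly by $$(1^{[r-1]}<\cdots<n^{[r-1]})<\cdots<(1^{[1]}<\cdots<n^{[1]})<(1<\cdots<n),$$ and with respect to this order $\mathrm{inv}(\pi):=|\{(i,j):i<j,\ \pi_i>\pi_j\}|$ and $\mathrm{maj}(\pi):=\sum_{1\le i\le n-1,\ \pi_i>\pi_{i+1}} i$. Define $\mathrm{fmaj}(\pi):=r\cdot\mathrm{maj}(\pi)+\sum_{i=1}^n z_i$, $\mathrm{rmaj}(\pi):=\mathrm{maj}(\pi)+\sum_{i=1}^n z_i\sigma_i$, and $\mathrm{rinv}(\pi):=\mathrm{inv}(\pi)+\sum_{i=1}^n z_i\sigma_i$. The flag maf index is $\mathrm{fmaf}(\pi):=r\sum_{j=1}^k(i_j-j)+\mathrm{fmaj}(\tilde\pi)$,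 where $\{i_1<i_2<\cdots<i_k\}=\mathrm{Fix}(\pi):=\{i:\pi_i=i\}$ (i.e. $\sigma_i=i$ and $z_i=0$), and $\tilde\pi\in G(r,n-k)$ is obtained from $\pi$ by deleting the fixed terms $\pi_{i_1},\dots,\pi_{i_k}$ and renumbering the absolute values of the remaining terms by $1,\dots,n-k$ preserving their relative order, keeping their colors (if $k=n$, $\tilde\pi$ is empty and $\mathrm{fmaj}(\tilde\pi)=0$). *)

theory Defs
  imports Main
begin

definition qbracket :: "nat \<Rightarrow> 'a::comm_ring_1 \<Rightarrow> 'a" where
  "qbracket m p = (\<Sum>i<m. p ^ i)"

text \<open>The pair \<open>(a, c)\<close> stands for the colored letter $a^{[c]}$. An element of $G(r,n)$ is
  represented by its word, so that the letter $\pi_i$ is \<open>w ! (i - 1)\<close>; positions are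
  numbered from 1, as in the definitions of the major index and of fixed points.\<close>

type_synonym colored_letter = "nat \<times> nat"
type_synonym colored_word = "colored_letter list"

definition colored_perms :: "nat \<Rightarrow> nat \<Rightarrow> colored_word set" where
  "colored_perms r n =
    {w. distinct (map fst w) \<and> set (map fst w) = {1..n} \<and> (\<forall>x \<in> set w. snd x < r)}"

definition letter :: "colored_word \<Rightarrow> nat \<Rightarrow> colored_letter" where
  "letter w i = w ! (i - 1)"

text \<open>Letters of a larger color are smaller; within one color the order is that of the
  absolute values.\<close>

definition letter_less :: "colored_letter \<Rightarrow> colored_letter \<Rightarrow> bool" where
  "letter_less x y \<longleftrightarrow> snd y < snd x \<or> (snd x = snd y \<and> fst x < fst y)"

definition inv_col :: "colored_word \<Rightarrow> nat" where
  "inv_col w =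
    card {(i, j). 1 \<le> i \<and> i < j \<and> j \<le> length w \<and> letter_less (letter w j) (letter w i)}"

definition maj :: "colored_word \<Rightarrow> nat" where
  "maj w = \<Sum>{i. 1 \<le> i \<and> i < length w \<and> letter_less (letter w (i + 1)) (letter w i)}"

definition fmaj :: "nat \<Rightarrow> colored_word \<Rightarrow> nat" where
  "fmaj r w = r * maj w + (\<Sum>i = 1..length w. snd (letter w i))"

definition rmaj :: "colored_word \<Rightarrow> nat" where
  "rmaj w = maj w + (\<Sum>i = 1..length w. snd (letter w i) * fst (letter w i))"

definition rinv :: "colored_word \<Rightarrow> nat" where
  "rinv w = inv_col w + (\<Sum>i = 1..length w. snd (letter w i) * fst (letter w i))"

definition Fix :: "colored_word \<Rightarrow> nat set" where
  "Fix w = {i. 1 \<le> i \<and> i \<le> length w \<and> letter w i = (i, 0)}"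

text \<open>Renumbering replaces each absolute value by its rank among those occurring in the word.\<close>

definition renumber :: "colored_word \<Rightarrow> colored_word" where
  "renumber v = map (\<lambda>(a, c). (card {b \<in> fst ` set v. b \<le> a}, c)) v"

text \<open>The function \<open>nths\<close> counts positions from 0, hence the shift by \<open>Suc\<close>.\<close>

definition delete_fixed :: "colored_word \<Rightarrow> colored_word" where
  "delete_fixed w = renumber (nths w {i. Suc i \<notin> Fix w})"

text \<open>The \<open>j\<close>-th smallest fixed point is at least \<open>j\<close>, so the subtraction on \<open>nat\<close> below is
  the ordinary one.\<close>

definition fmaf :: "nat \<Rightarrow> colored_word \<Rightarrow> nat" where
  "fmaf r w =
    r * (\<Sum>j = 1..card (Fix w). sorted_list_of_set (Fix w) ! (j - 1) - j)
      + fmaj r (delete_fixed w)"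

lemma length_colored_perms: "w \<in> colored_perms r n \<Longrightarrow> length w = n"
  unfolding colored_perms_def
  by (metis (mono_tags, lifting) card_atLeastAtMost diff_Suc_1 distinct_card length_map mem_Collect_eq)

lemma finite_colored_perms: "finite (colored_perms r n)"
proof (rule finite_subset)
  show "colored_perms r n \<subseteq> {w. set w \<subseteq> {1..n} \<times> {..<r} \<and> length w = n}"
  proof
    fix w assume w: "w \<in> colored_perms r n"
    then have "set w \<subseteq> {1..n} \<times> {..<r}"
      unfolding colored_perms_def by (force simp flip: atLeastAtMost_iff)
    with w show "w \<in> {w. set w \<subseteq> {1..n} \<times> {..<r} \<and> length w = n}"
      using length_colored_perms by blast
  qed
  show "finite {w. set w \<subseteq> {1..n} \<times> {..<r} \<and> length w = n}"
    by (intro finite_lists_length_eq) auto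
qed

end

theory Submission
  imports Defs "HOL-Combinatorics.Multiset_Permutations"
begin

text \<open>
  Since \<open>r\<close> is even, only the parity of the color sum survives in the sign: the terms of \<open>fmaf\<close>
  with the factor \<open>r\<close> are even, and the deleted fixed points have color 0, so
  \<open>(-1) ^ fmaf r w\<close> is \<open>-1\<close> to the power of the sum of the colors of \<open>w\<close> (\<open>minus_one_power_fmaf\<close>).

  Both this sign and the sum of color times absolute value depend only on the set of letters of
  \<open>w\<close>, that is, on the function \<open>c\<close> giving each absolute value its color.  For a fixed \<open>c\<close> the
  words of \<open>G(r,n)\<close> with these letters are all the arrangements of \<open>n\<close> distinct letters of a
  linearly ordered set, so MacMahon's theorem evaluates the sum of \<open>q ^ inv\<close> and the sum of
  \<open>q ^ maj\<close> over them to the same \<open>q\<close>-factorial, whatever \<open>c\<close> is.  What remains,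
  the sum over \<open>c\<close> of the product of the \<open>(- q ^ a) ^ c a\<close>, factors into the brackets
  \<open>[r]\<close> at \<open>- q ^ a\<close>.

  MacMahon's theorem is obtained here in a form refined by the last letter \<open>x\<close>: for both
  statistics the arrangements of \<open>A\<close> that end in \<open>x\<close> contribute
  \<open>q\<close> to the power of the number of letters of \<open>A\<close> above \<open>x\<close>, times the \<open>q\<close>-factorial of \<open>card A - 1\<close>.
  The refinement is what makes the induction for \<open>maj\<close> work, since whether a new last letter
  creates a descent depends on the previous last letter only.
\<close>

section \<open>Ranks of colored letters\<close>

definition num_above :: "colored_letter set \<Rightarrow> colored_letter \<Rightarrow> nat" where
  "num_above A x = card {y \<in> A. letter_less x y}"

lemma letter_less_irrefl [simp]: "\<not> letter_less x x"
  by (simp add: letter_less_def)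

lemma letter_less_trans: "letter_less x y \<Longrightarrow> letter_less y z \<Longrightarrow> letter_less x z"
  by (auto simp: letter_less_def)

lemma letter_less_total: "x \<noteq> y \<Longrightarrow> letter_less x y \<or> letter_less y x"
  by (auto simp: letter_less_def prod_eq_iff)

lemma num_above_Diff_self: "num_above (A - {x}) x = num_above A x"
  unfolding num_above_def by (rule arg_cong[of _ _ card]) auto

lemma num_above_less_card:
  assumes "finite A" "x \<in> A"
  shows "num_above A x < card A"
  unfolding num_above_def
proof (rule psubset_card_mono)
  have "x \<notin> {y \<in> A. letter_less x y}"
    by simp
  with assms(2) show "{y \<in> A. letter_less x y} \<subset> A"
    by blast
qed (use assms in simp)

lemma num_above_strict_antimono:
  assumes "finite A" "y \<in> A" "letter_less x y"
  shows "num_above A y < num_above A x"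
  unfolding num_above_def
proof (rule psubset_card_mono)
  have "y \<in> {z \<in> A. letter_less x z} - {z \<in> A. letter_less y z}"
    using assms by simp
  then show "{z \<in> A. letter_less y z} \<subset> {z \<in> A. letter_less x z}"
    using assms by (blast intro: letter_less_trans)
qed (use assms in simp)

lemma bij_betw_num_above:
  assumes "finite A"
  shows "bij_betw (num_above A) A {..<card A}"
proof -
  have inj: "inj_on (num_above A) A"
    using num_above_strict_antimono[OF assms] letter_less_total
    by (metis inj_onI less_irrefl)
  moreover have "num_above A ` A = {..<card A}"
  proof (rule card_subset_eq)
    show "num_above A ` A \<subseteq> {..<card A}"
      using num_above_less_card[OF assms] by auto
    show "card (num_above A ` A) = card {..<card A}"
      using card_image[OF inj] by simp
  qed simp
  ultimately show ?thesis
    by (simp add: bij_betw_def)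
qed

lemma sum_power_num_above:
  fixes q :: "'a::comm_ring_1"
  assumes "finite A"
  shows "(\<Sum>x\<in>A. q ^ num_above A x) = qbracket (card A) q"
  unfolding qbracket_def
  using sum.reindex_bij_betw[OF bij_betw_num_above[OF assms], of "\<lambda>j. q ^ j"] .

text \<open>This turns the descent condition into a condition on ranks, so that a sum over the letters
  of \<open>B\<close> involving it can be reindexed by rank.\<close>

lemma letter_less_iff_num_above:
  assumes "finite B" "x \<notin> B" "y \<in> B"
  shows "letter_less x y \<longleftrightarrow> num_above B y < num_above B x"
proof
  assume "num_above B y < num_above B x"
  moreover have "num_above B x \<le> num_above B y" if "letter_less y x"
    unfolding num_above_def using assms that
    by (intro card_mono) (auto intro: letter_less_trans)
  ultimately show "letter_less x y"
    using letter_less_total[of x y] assms by fastforce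
qed (use assms num_above_strict_antimono in blast)

text \<open>If \<open>x\<close> has rank \<open>u\<close>, the ranks in \<open>B\<close> below \<open>u\<close> are shifted up by \<open>card B\<close>, which turns
  the exponents \<open>0, \<dots>, card B - 1\<close> into the consecutive exponents \<open>u, \<dots>, u + card B - 1\<close>.  The
  shift is the contribution to \<open>maj\<close> of a descent created by putting \<open>x\<close> after a word
  on \<open>B\<close>.\<close>

lemma sum_power_num_above_shifted:
  fixes q :: "'a::comm_ring_1"
  assumes "finite B" "x \<notin> B"
  shows "(\<Sum>y\<in>B. q ^ ((if letter_less x y then card B else 0) + num_above B y)) =
         q ^ num_above B x * qbracket (card B) q"
proof -
  define m u where "m = card B" and "u = num_above B x"
  have "u \<le> m"
    unfolding u_def m_def num_above_def using assms by (intro card_mono) auto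
  have "(\<Sum>y\<in>B. q ^ ((if letter_less x y then m else 0) + num_above B y)) =
        (\<Sum>y\<in>B. q ^ ((if num_above B y < u then m else 0) + num_above B y))"
    by (intro sum.cong) (simp_all add: letter_less_iff_num_above[OF assms] u_def)
  also have "\<dots> = (\<Sum>j<m. q ^ ((if j < u then m else 0) + j))"
    unfolding m_def
    using sum.reindex_bij_betw[OF bij_betw_num_above[OF assms(1)],
        of "\<lambda>j. q ^ ((if j < u then card B else 0) + j)"] .
  also have "\<dots> = (\<Sum>j<u. q ^ (m + j)) + (\<Sum>j=u..<m. q ^ j)"
  proof -
    have "{..<m} = {..<u} \<union> {u..<m}"
      using \<open>u \<le> m\<close> by auto
    then show ?thesis
      by (simp add: sum.union_disjoint ivl_disj_int)
  qed
  also have "(\<Sum>j<u. q ^ (m + j)) = (\<Sum>j=m..<u+m. q ^ j)"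
    using sum.shift_bounds_nat_ivl[of "\<lambda>j. q ^ j" 0 m u]
    by (simp add: atLeast0LessThan add.commute)
  also have "(\<Sum>j=m..<u+m. q ^ j) + (\<Sum>j=u..<m. q ^ j) = (\<Sum>j=u..<u+m. q ^ j)"
    using sum.atLeastLessThan_concat[of u m "u + m" "\<lambda>j. q ^ j"] \<open>u \<le> m\<close>
    by (simp add: add.commute)
  also have "\<dots> = q ^ u * qbracket m q"
    using sum.shift_bounds_nat_ivl[of "\<lambda>j. q ^ j" 0 u m]
    by (simp add: atLeast0LessThan add.commute power_add qbracket_def sum_distrib_left
        mult.commute)
  finally show ?thesis
    unfolding m_def u_def .
qed

section \<open>Appending a letter to a word\<close>

lemma letter_append_less: "1 \<le> i \<Longrightarrow> i \<le> length w \<Longrightarrow> letter (w @ v) i = letter w i"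
  by (auto simp: letter_def nth_append)

lemma letter_append_last [simp]: "letter (w @ [x]) (Suc (length w)) = x"
  by (simp add: letter_def)

lemma sum_letter_conv_sum_list: "(\<Sum>i = 1..length w. f (letter w i)) = sum_list (map f w)"
  unfolding letter_def sum_list_sum_nth
  using sum.shift_bounds_nat_ivl[of "\<lambda>i. f (w ! (i - 1))" 0 1 "length w"]
  by (simp add: atLeastLessThanSuc_atLeastAtMost)

lemma inv_col_snoc:
  assumes "distinct w"
  shows "inv_col (w @ [x]) = inv_col w + num_above (set w) x"
proof -
  define I where "I = {(i, j). 1 \<le> i \<and> i < j \<and> j \<le> length w \<and> letter_less (letter w j) (letter w i)}"
  define L where "L = {i. i < length w \<and> letter_less x (w ! i)}"
  have split: "{(i, j). 1 \<le> i \<and> i < j \<and> j \<le> length (w @ [x]) \<and>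
          letter_less (letter (w @ [x]) j) (letter (w @ [x]) i)} =
        I \<union> (\<lambda>i. (Suc i, Suc (length w))) ` L" (is "?J = ?K")
  proof (rule set_eqI)
    fix p :: "nat \<times> nat"
    obtain i j where p: "p = (i, j)" by (cases p)
    consider "j \<le> length w" | "j = Suc (length w)" | "j > Suc (length w)" by linarith
    then show "p \<in> ?J \<longleftrightarrow> p \<in> ?K"
    proof cases
      case 2
      then show ?thesis
        by (cases i) (auto simp: p I_def L_def letter_append_less letter_def nth_append)
    qed (auto simp: p I_def L_def letter_append_less)
  qed
  have "finite I"
    by (rule finite_subset[of _ "{..length w} \<times> {..length w}"]) (auto simp: I_def)
  moreover have "finite L"
    by (simp add: L_def)
  moreover have "I \<inter> (\<lambda>i. (Suc i, Suc (length w))) ` L = {}"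
    by (auto simp: I_def)
  ultimately have "inv_col (w @ [x]) = card I + card L"
    unfolding inv_col_def split
    by (simp add: card_Un_disjoint card_image inj_on_def)
  moreover have "card L = num_above (set w) x"
  proof -
    have "(!) w ` L = {y \<in> set w. letter_less x y}"
      by (force simp: L_def in_set_conv_nth image_iff)
    moreover have "inj_on ((!) w) L"
      using assms by (auto simp: L_def inj_on_def nth_eq_iff_index_eq)
    ultimately show ?thesis
      unfolding num_above_def by (metis card_image)
  qed
  ultimately show ?thesis
    by (simp add: inv_col_def I_def)
qed

lemma maj_snoc:
  "maj (w @ [y, x]) = (if letter_less x y then Suc (length w) else 0) + maj (w @ [y])"
proof -
  let ?v = "w @ [y]"
  let ?D = "\<lambda>v. {i. 1 \<le> i \<and> i < length v \<and> letter_less (letter v (i + 1)) (letter v i)}"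
  have "?D (?v @ [x]) = ?D ?v \<union> (if letter_less x y then {Suc (length w)} else {})"
  proof (rule set_eqI)
    fix i
    consider "i < length ?v" | "i = length ?v" | "i > length ?v" by linarith
    then show "i \<in> ?D (?v @ [x]) \<longleftrightarrow>
        i \<in> ?D ?v \<union> (if letter_less x y then {Suc (length w)} else {})"
    proof cases
      case 1
      then have "letter (?v @ [x]) (i + 1) = letter ?v (i + 1)"
        by (intro letter_append_less) simp_all
      moreover have "letter (?v @ [x]) i = letter ?v i" if "1 \<le> i"
        using 1 that by (intro letter_append_less) simp_all
      ultimately show ?thesis
        using 1 by auto
    next
      case 2
      then show ?thesis
        by (simp add: letter_def nth_append)
    qed auto
  qed
  then show ?thesis
    unfolding maj_def by (simp add: sum.union_disjoint)
qed

section \<open>MacMahon's theorem refined by the last letter\<close>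

lemma permutations_of_set_snoc:
  assumes "A \<noteq> {}"
  shows "permutations_of_set A = (\<Union>x\<in>A. (\<lambda>w. w @ [x]) ` permutations_of_set (A - {x}))"
proof (intro equalityI subsetI)
  fix w assume w: "w \<in> permutations_of_set A"
  with assms obtain v x where "w = v @ [x]"
    by (cases w rule: rev_cases) (auto simp: permutations_of_set_def)
  with w show "w \<in> (\<Union>x\<in>A. (\<lambda>w. w @ [x]) ` permutations_of_set (A - {x}))"
    by (auto simp: permutations_of_set_def)
next
  fix w assume "w \<in> (\<Union>x\<in>A. (\<lambda>w. w @ [x]) ` permutations_of_set (A - {x}))"
  then obtain x v where "x \<in> A" "w = v @ [x]" "v \<in> permutations_of_set (A - {x})"
    by blast
  moreover from this have "set v = A - {x}" "distinct v"
    by (simp_all add: permutations_of_set_def)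
  ultimately show "w \<in> permutations_of_set A"
    by (simp add: permutations_of_set_def insert_absorb del: insert_Diff_single) blast
qed

lemma sum_permutations_of_set_snoc:
  fixes f :: "'b list \<Rightarrow> 'a::comm_monoid_add"
  assumes "finite A" "A \<noteq> {}"
  shows "sum f (permutations_of_set A) =
         (\<Sum>x\<in>A. \<Sum>w\<in>permutations_of_set (A - {x}). f (w @ [x]))"
proof -
  have "sum f (permutations_of_set A) =
        (\<Sum>x\<in>A. sum f ((\<lambda>w. w @ [x]) ` permutations_of_set (A - {x})))"
    unfolding permutations_of_set_snoc[OF assms(2)]
    using assms by (intro sum.UNION_disjoint) auto
  also have "\<dots> = (\<Sum>x\<in>A. \<Sum>w\<in>permutations_of_set (A - {x}). f (w @ [x]))"
    by (intro sum.cong refl sum.reindex[unfolded comp_def]) (simp add: inj_on_def)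
  finally show ?thesis .
qed

text \<open>The ranks of the letters of \<open>A\<close> are \<open>0, \<dots>, card A - 1\<close>, so summing the contributions of
  the possible last letters supplies the missing factor \<open>[card A]\<close> of the \<open>q\<close>-factorial.\<close>

lemma sum_permutations_of_set_from_last:
  fixes q :: "'a::comm_ring_1"
  assumes "finite A" "A \<noteq> {}"
    and last: "\<And>x. x \<in> A \<Longrightarrow>
      (\<Sum>w\<in>permutations_of_set (A - {x}). f (w @ [x])) =
      q ^ num_above A x * (\<Prod>k = 1..card A - 1. qbracket k q)"
  shows "sum f (permutations_of_set A) = (\<Prod>k = 1..card A. qbracket k q)"
proof -
  have "card A > 0"
    using assms(1,2) by (simp add: card_gt_0_iff)
  then obtain n where n: "card A = Suc n"
    using gr0_implies_Suc by blast
  have "sum f (permutations_of_set A) =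
      (\<Sum>x\<in>A. q ^ num_above A x) * (\<Prod>k = 1..card A - 1. qbracket k q)"
    by (simp add: sum_permutations_of_set_snoc[OF assms(1,2)] last sum_distrib_right)
  then show ?thesis
    by (simp add: sum_power_num_above[OF assms(1)] n mult.commute)
qed

theorem sum_power_inv_col:
  fixes q :: "'a::comm_ring_1"
  assumes "finite A"
  shows "(\<Sum>w\<in>permutations_of_set A. q ^ inv_col w) = (\<Prod>k = 1..card A. qbracket k q)"
  using assms
proof (induction "card A" arbitrary: A)
  case 0
  have "{(i, j). 1 \<le> i \<and> i < j \<and> j \<le> length [] \<and> letter_less (letter [] j) (letter [] i)} = {}"
    by auto
  then have "inv_col [] = 0"
    unfolding inv_col_def by (metis card.empty)
  then show ?case
    using 0 by simp
next
  case (Suc n)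
  show ?case
  proof (rule sum_permutations_of_set_from_last)
    fix x assume x: "x \<in> A"
    have "(\<Sum>w\<in>permutations_of_set (A - {x}). q ^ inv_col (w @ [x])) =
        q ^ num_above A x * (\<Sum>w\<in>permutations_of_set (A - {x}). q ^ inv_col w)"
      unfolding sum_distrib_left
      by (intro sum.cong refl)
        (auto simp: inv_col_snoc permutations_of_set_def num_above_Diff_self power_add mult.commute)
    also have "(\<Sum>w\<in>permutations_of_set (A - {x}). q ^ inv_col w) =
        (\<Prod>k = 1..card A - 1. qbracket k q)"
      using Suc.hyps(1)[of "A - {x}"] Suc.hyps(2) Suc.prems x by simp
    finally show "(\<Sum>w\<in>permutations_of_set (A - {x}). q ^ inv_col (w @ [x])) =
        q ^ num_above A x * (\<Prod>k = 1..card A - 1. qbracket k q)" .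
  qed (use Suc in auto)
qed

text \<open>Splitting by the last two letters \<open>y\<close> and \<open>x\<close>, a descent at the end adds \<open>card A - 1\<close>
  exactly when \<open>y\<close> is above \<open>x\<close>, so the sum over \<open>y\<close> is a shifted rank sum.\<close>

lemma sum_power_maj_last:
  fixes q :: "'a::comm_ring_1"
  assumes "finite A" "x \<in> A"
  shows "(\<Sum>w\<in>permutations_of_set (A - {x}). q ^ maj (w @ [x])) =
         q ^ num_above A x * (\<Prod>k = 1..card A - 1. qbracket k q)"
  using assms
proof (induction "card A - 1" arbitrary: A x)
  case 0
  then have "card (A - {x}) = 0"
    by simp
  with 0 have "A = {x}"
    by (metis card_0_eq finite_Diff insert_Diff)
  moreover have "maj [x] = 0"
    by (simp add: maj_def)
  moreover have "num_above {x} x = 0"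
    using num_above_less_card[of "{x}" x] by simp
  ultimately show ?case
    by simp
next
  case (Suc n)
  define B where "B = A - {x}"
  have B: "finite B" "x \<notin> B" "card B = Suc n"
    using Suc.prems Suc.hyps(2) by (auto simp: B_def)
  then have "B \<noteq> {}"
    by auto
  have "(\<Sum>w\<in>permutations_of_set B. q ^ maj (w @ [x])) =
      (\<Sum>y\<in>B. \<Sum>w\<in>permutations_of_set (B - {y}). q ^ maj (w @ [y, x]))"
    by (simp add: sum_permutations_of_set_snoc[OF B(1) \<open>B \<noteq> {}\<close>])
  also have "\<dots> = (\<Sum>y\<in>B. q ^ (if letter_less x y then card B else 0) *
      (\<Sum>w\<in>permutations_of_set (B - {y}). q ^ maj (w @ [y])))"
  proof (rule sum.cong[OF refl])
    fix y assume "y \<in> B"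
    then have "Suc (length w) = card B" if "w \<in> permutations_of_set (B - {y})" for w
      using that B length_finite_permutations_of_set[OF that] by simp
    then show "(\<Sum>w\<in>permutations_of_set (B - {y}). q ^ maj (w @ [y, x])) =
        q ^ (if letter_less x y then card B else 0) *
        (\<Sum>w\<in>permutations_of_set (B - {y}). q ^ maj (w @ [y]))"
      unfolding sum_distrib_left by (intro sum.cong refl) (simp add: maj_snoc power_add)
  qed
  also have "\<dots> = (\<Sum>y\<in>B. q ^ (if letter_less x y then card B else 0) *
      (q ^ num_above B y * (\<Prod>k = 1..n. qbracket k q)))"
    using Suc.hyps(1)[of B] B by (intro sum.cong refl) simp
  also have "\<dots> = (\<Sum>y\<in>B. q ^ ((if letter_less x y then card B else 0) + num_above B y)) *
      (\<Prod>k = 1..n. qbracket k q)"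
    by (simp add: sum_distrib_right power_add mult.assoc)
  also have "\<dots> = q ^ num_above B x * (qbracket (Suc n) q * (\<Prod>k = 1..n. qbracket k q))"
    by (simp add: sum_power_num_above_shifted[OF B(1,2)] B(3) mult.assoc)
  also have "\<dots> = q ^ num_above A x * (\<Prod>k = 1..card A - 1. qbracket k q)"
    unfolding Suc.hyps(2)[symmetric] by (simp add: B_def num_above_Diff_self mult.commute)
  finally show ?case
    by (simp add: B_def)
qed

theorem sum_power_maj:
  fixes q :: "'a::comm_ring_1"
  assumes "finite A"
  shows "(\<Sum>w\<in>permutations_of_set A. q ^ maj w) = (\<Prod>k = 1..card A. qbracket k q)"
proof (cases "A = {}")
  case True
  then show ?thesis
    by (simp add: maj_def)
next
  case False
  then show ?thesis
    using assms by (intro sum_permutations_of_set_from_last sum_power_maj_last)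
qed

section \<open>The sign of the flag maf index\<close>

lemma sum_list_nths_eq:
  fixes f :: "'b \<Rightarrow> 'a::comm_monoid_add"
  assumes "\<And>i. i < length w \<Longrightarrow> i \<notin> I \<Longrightarrow> f (w ! i) = 0"
  shows "sum_list (map f (nths w I)) = sum_list (map f w)"
  using assms
proof (induction w rule: rev_induct)
  case (snoc x w)
  have "sum_list (map f (nths w I)) = sum_list (map f w)"
  proof (rule snoc.IH)
    fix i assume "i < length w" "i \<notin> I"
    then show "f (w ! i) = 0"
      using snoc.prems[of i] by (simp add: nth_append)
  qed
  moreover have "f x = 0" if "length w \<notin> I"
    using snoc.prems[of "length w"] that by simp
  ultimately show ?case
    by (simp add: nths_append nths_singleton)
qed simp

lemma sum_list_colors_delete_fixed:
  "sum_list (map snd (delete_fixed w)) = sum_list (map snd w)"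
proof -
  have "map snd (delete_fixed w) = map snd (nths w {i. Suc i \<notin> Fix w})"
    by (simp add: delete_fixed_def renumber_def case_prod_unfold)
  also have "sum_list \<dots> = sum_list (map snd w)"
    by (rule sum_list_nths_eq) (auto simp: Fix_def letter_def)
  finally show ?thesis .
qed

lemma minus_one_power_fmaf:
  assumes "even r"
  shows "(-1 :: 'a::ring_1) ^ fmaf r w = (-1) ^ sum_list (map snd w)"
  using assms unfolding fmaf_def fmaj_def sum_letter_conv_sum_list sum_list_colors_delete_fixed
  by (simp add: power_add power_mult)

section \<open>Splitting by the coloring of the absolute values\<close>

definition letters_of_coloring :: "nat \<Rightarrow> (nat \<Rightarrow> nat) \<Rightarrow> colored_letter set" where
  "letters_of_coloring n c = (\<lambda>a. (a, c a)) ` {1..n}"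

lemma finite_letters_of_coloring [simp]: "finite (letters_of_coloring n c)"
  by (simp add: letters_of_coloring_def)

lemma card_letters_of_coloring [simp]: "card (letters_of_coloring n c) = n"
  by (simp add: letters_of_coloring_def card_image inj_on_def)

lemma sum_list_letters_of_coloring:
  assumes "w \<in> permutations_of_set (letters_of_coloring n c)"
  shows "sum_list (map f w) = (\<Sum>a = 1..n. f (a, c a))"
proof -
  have "sum_list (map f w) = sum f (set w)"
    using assms by (simp add: permutations_of_set_def sum_list_distinct_conv_sum_set)
  also have "set w = letters_of_coloring n c"
    using assms by (simp add: permutations_of_set_def)
  also have "sum f \<dots> = (\<Sum>a = 1..n. f (a, c a))"
    unfolding letters_of_coloring_def by (subst sum.reindex) (simp_all add: inj_on_def)
  finally show ?thesis .
qed

lemma colored_perms_eq_UN_colorings: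
  "colored_perms r n =
    (\<Union>c\<in>{1..n} \<rightarrow>\<^sub>E {..<r}. permutations_of_set (letters_of_coloring n c))"
proof (intro equalityI subsetI)
  fix w assume w: "w \<in> colored_perms r n"
  then have dist: "distinct (map fst w)" and abs: "fst ` set w = {1..n}"
    and col: "\<And>x. x \<in> set w \<Longrightarrow> snd x < r"
    by (auto simp: colored_perms_def)
  \<comment> \<open>A word is an association list from absolute values to colors.\<close>
  define c where "c = (\<lambda>a\<in>{1..n}. the (map_of w a))"
  have c: "c a = b" if "(a, b) \<in> set w" for a b
  proof -
    have "a \<in> {1..n}"
      using that abs by force
    then show ?thesis
      using dist that by (simp add: c_def)
  qed
  have "set w = letters_of_coloring n c"
    unfolding letters_of_coloring_def abs[symmetric] using c by (force simp: image_iff)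
  moreover have "c \<in> {1..n} \<rightarrow>\<^sub>E {..<r}"
  proof (rule PiE_I)
    fix a assume "a \<in> {1..n}"
    then obtain b where "(a, b) \<in> set w"
      using abs by force
    then show "c a \<in> {..<r}"
      using c col by force
  qed (auto simp: c_def)
  ultimately show "w \<in> (\<Union>c\<in>{1..n} \<rightarrow>\<^sub>E {..<r}. permutations_of_set (letters_of_coloring n c))"
    using dist by (auto simp: permutations_of_set_def distinct_map)
next
  fix w assume "w \<in> (\<Union>c\<in>{1..n} \<rightarrow>\<^sub>E {..<r}. permutations_of_set (letters_of_coloring n c))"
  then obtain c where c: "c \<in> {1..n} \<rightarrow>\<^sub>E {..<r}" and w: "set w = letters_of_coloring n c" "distinct w"
    by (auto simp: permutations_of_set_def)
  have "inj_on fst (set w)"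
    by (auto simp: w letters_of_coloring_def inj_on_def)
  moreover have "fst ` set w = {1..n}"
    by (simp add: w letters_of_coloring_def image_image)
  moreover have "\<forall>x\<in>set w. snd x < r"
    using c by (auto simp: w letters_of_coloring_def)
  ultimately show "w \<in> colored_perms r n"
    using w(2) by (simp add: colored_perms_def distinct_map)
qed

lemma permutations_of_letters_disjoint:
  assumes "c \<in> {1..n} \<rightarrow>\<^sub>E S" "d \<in> {1..n} \<rightarrow>\<^sub>E S" "c \<noteq> d"
  shows "permutations_of_set (letters_of_coloring n c) \<inter>
         permutations_of_set (letters_of_coloring n d) = {}"
proof -
  obtain a where "a \<in> {1..n}" "c a \<noteq> d a"
    using assms by (metis PiE_ext)
  then have "(a, c a) \<in> letters_of_coloring n c" "(a, c a) \<notin> letters_of_coloring n d"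
    by (auto simp: letters_of_coloring_def)
  then show ?thesis
    by (auto simp: permutations_of_set_def)
qed

text \<open>On the arrangements of the letters of a coloring \<open>c\<close> the sign and the color weight are
  constant, equal to the product of the \<open>(- q ^ a) ^ c a\<close>, so \<open>s\<close> enters only through its
  distribution there, which the hypothesis makes independent of \<open>c\<close>.\<close>

lemma signed_sum_colored_perms:
  fixes q :: "'a::comm_ring_1" and s :: "colored_word \<Rightarrow> nat"
  assumes macmahon: "\<And>A. finite A \<Longrightarrow>
    (\<Sum>w\<in>permutations_of_set A. q ^ s w) = (\<Prod>k = 1..card A. qbracket k q)"
  shows "(\<Sum>w\<in>colored_perms r n. (-1) ^ sum_list (map snd w) *
            q ^ (s w + sum_list (map (\<lambda>x. snd x * fst x) w))) =
         (\<Prod>k = 1..n. qbracket r (- (q ^ k)) * qbracket k q)"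
    (is "sum ?F _ = _")
proof -
  let ?C = "{1..n} \<rightarrow>\<^sub>E {..<r}"
  let ?P = "\<lambda>c. permutations_of_set (letters_of_coloring n c)"
  have "sum ?F (colored_perms r n) = (\<Sum>c\<in>?C. sum ?F (?P c))"
    unfolding colored_perms_eq_UN_colorings
    by (intro sum.UNION_disjoint finite_PiE ballI impI permutations_of_letters_disjoint) auto
  also have "\<dots> = (\<Sum>c\<in>?C. (\<Prod>a = 1..n. (- (q ^ a)) ^ c a) * (\<Prod>k = 1..n. qbracket k q))"
  proof (rule sum.cong[OF refl])
    fix c
    have weight: "?F w = (\<Prod>a = 1..n. (- (q ^ a)) ^ c a) * q ^ s w" if "w \<in> ?P c" for w
    proof -
      have "(- (q ^ a)) ^ c a = (-1) ^ c a * q ^ (c a * a)" for a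
        by (subst power_minus) (simp add: mult.commute flip: power_mult)
      then show ?thesis
        by (simp add: sum_list_letters_of_coloring[OF that] power_add power_sum prod.distrib
            mult_ac)
    qed
    have "sum ?F (?P c) = (\<Prod>a = 1..n. (- (q ^ a)) ^ c a) * (\<Sum>w\<in>?P c. q ^ s w)"
      unfolding sum_distrib_left by (rule sum.cong[OF refl weight])
    then show "sum ?F (?P c) =
        (\<Prod>a = 1..n. (- (q ^ a)) ^ c a) * (\<Prod>k = 1..n. qbracket k q)"
      by (simp add: macmahon)
  qed
  also have "\<dots> = (\<Prod>a = 1..n. \<Sum>j<r. (- (q ^ a)) ^ j) * (\<Prod>k = 1..n. qbracket k q)"
    by (simp add: prod_sum_PiE sum_distrib_right)
  finally show ?thesis
    by (simp add: prod.distrib qbracket_def)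
qed

theorem theorem5p7:
  fixes r n :: nat and q :: "'a::comm_ring_1"
  assumes "r \<ge> 1" and "n \<ge> 1" and "even r"
  shows "(\<Sum>w \<in> colored_perms r n. (-1) ^ fmaf r w * q ^ rinv w) =
         (\<Sum>w \<in> colored_perms r n. (-1) ^ fmaf r w * q ^ rmaj w) \<and>
         (\<Sum>w \<in> colored_perms r n. (-1) ^ fmaf r w * q ^ rmaj w) =
         (\<Prod>k = 1..n. qbracket r (- (q ^ k)) * qbracket k q)"
proof -
  have rinv: "rinv w = inv_col w + sum_list (map (\<lambda>x. snd x * fst x) w)" for w
    unfolding rinv_def by (subst sum_letter_conv_sum_list[symmetric]) (rule refl)
  have rmaj: "rmaj w = maj w + sum_list (map (\<lambda>x. snd x * fst x) w)" for w
    unfolding rmaj_def by (subst sum_letter_conv_sum_list[symmetric]) (rule refl)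
  have "(\<Sum>w \<in> colored_perms r n. (-1) ^ fmaf r w * q ^ rinv w) =
      (\<Prod>k = 1..n. qbracket r (- (q ^ k)) * qbracket k q)"
    unfolding minus_one_power_fmaf[OF \<open>even r\<close>] rinv
    by (rule signed_sum_colored_perms[OF sum_power_inv_col])
  moreover have "(\<Sum>w \<in> colored_perms r n. (-1) ^ fmaf r w * q ^ rmaj w) =
      (\<Prod>k = 1..n. qbracket r (- (q ^ k)) * qbracket k q)"
    unfolding minus_one_power_fmaf[OF \<open>even r\<close>] rmaj
    by (rule signed_sum_colored_perms[OF sum_power_maj])
  ultimately show ?thesis
    by simp
qed

end
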